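(* Let $X$ be an integrable real-valued random variable, let $n\ge 2$ be an integer, and assume $\mathsf{E}\big[|X-\mathsf{E}[X]|^n\big]<\infty$. Then $$|\kappa_n(X)|\le C^{\mathrm{cen}}_n\,\mathsf{E}\big[|X-\mathsf{E}[X]|^n\big],\qquad C^{\mathrm{cen}}_n:=\sum_{\pi\in\mathcal{P}_{\ge 2}(n)}(|\pi|-1)!.$$ Moreover, $$C^{\mathrm{cen}}_n\sim\frac{(n-1)!}{\rho_{\mathrm{cen}}^{\,n}}\qquad(n\to\infty),$$ where $\rho_{\mathrm{cen}}>0$ is the unique positive solution of $e^{\rho_{\mathrm{cen}}}=2+\rho_{\mathrm{cen}}$.
   Context: $\mathcal{P}(n)$ is the set of all set partitions of $\{1,\dots,n\}$ into nonempty blocks, $|\pi|$ is the number of blocks of $\pi$, and $\mathcal{P}_{\ge2}(n)=\{\pi\in\mathcal{P}(n): |B|\ge 2\text{ for every }B\in\pi\}$. For a random variable $X$ with $\mathsf{E}[|X|^n]<\infty$, write $m_k=\mathsf{E}[X^k]$ for $1\le k\le n$; the $n$-th cumulant is $$\kappa_n(X)=\sum_{\pi\in\mathcal{P}(n)}(-1)^{|\pi|-1}(|\pi|-1)!\prod_{B\in\pi}m_{|B|}.$$ The notation $a_n\sim b_n$ means $a_n/b_n\to1$. *)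

theory Defs
  imports "HOL-Probability.Probability"
begin

definition set_partitions :: "nat \<Rightarrow> nat set set set" where
  "set_partitions n = {\<pi>. partition_on {1..n} \<pi>}"

definition set_partitions_ge2 :: "nat \<Rightarrow> nat set set set" where
  "set_partitions_ge2 n = {\<pi> \<in> set_partitions n. \<forall>B\<in>\<pi>. 2 \<le> card B}"

definition moment :: "'a measure \<Rightarrow> ('a \<Rightarrow> real) \<Rightarrow> nat \<Rightarrow> real" where
  "moment M X k = (\<integral>\<omega>. X \<omega> ^ k \<partial>M)"

(* Meaningful for n >= 1 and X in L^n. For n >= 1 every partition has at least one block,
   so the subtraction card \<pi> - 1 on nat does not truncate. *)
definition cumulant :: "'a measure \<Rightarrow> ('a \<Rightarrow> real) \<Rightarrow> nat \<Rightarrow> real" where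
  "cumulant M X n =
     (\<Sum>\<pi>\<in>set_partitions n. (- 1) ^ (card \<pi> - 1) * fact (card \<pi> - 1) *
        (\<Prod>B\<in>\<pi>. moment M X (card B)))"

definition C_cen :: "nat \<Rightarrow> real" where
  "C_cen n = (\<Sum>\<pi>\<in>set_partitions_ge2 n. fact (card \<pi> - 1))"

end

theory Submission
  imports Defs "HOL-Complex_Analysis.Complex_Analysis"
begin

text \<open>Both halves rest on the exponential formula: a sum over all set partitions of an \<open>n\<close>-element set, in
  which a partition with \<open>k\<close> blocks is weighted by \<open>f k\<close> and each block \<open>B\<close> by \<open>a (card B)\<close>, is
  \<open>n!\<close> times the \<open>n\<close>-th coefficient of \<open>F(A(x))\<close>, where \<open>F\<close> and \<open>A\<close> are the exponential generating
  functions of \<open>f\<close> and \<open>a\<close> (\<open>partition_sum_eq_egf_compose\<close>). For weights of modulus \<open>(k - 1)!\<close>, \<open>F\<close> is a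
  logarithm (\<open>partition_sum_log_weights\<close>).

  For the inequality, the cumulants are the coefficients of the logarithm of the moment generating
  series. Adding a constant \<open>\<mu>\<close> to the variable multiplies that series by \<open>exp (\<mu> x)\<close> and changes its
  logarithm in degree 1 only, so for \<open>n \<ge> 2\<close> the variable may be centred (\<open>cumulant_add_const\<close>). The
  first moment then vanishes, only partitions without singletons remain, and Lyapunov's inequality
  bounds each remaining product of moments by the \<open>n\<close>-th absolute moment (\<open>abs_cumulant_le\<close>).

  For the asymptotics, the same formula gives \<open>C_cen (n + 1) / n!\<close> as the \<open>n\<close>-th coefficient of
  \<open>(exp z - 1) / (2 + z - exp z)\<close>, which is minus the logarithmic derivative of the denominator
  (\<open>C_cen_Suc_eq_coefficient\<close>). In the closed disc of radius \<open>\<rho>\<close> the denominator vanishes at \<open>\<rho>\<close> only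
  (\<open>exp_eq_2_plus_in_disc\<close>), with a simple zero. So \<open>\<rho>\<close> is the dominant singularity, a pole of residue
  -1, and the \<open>n\<close>-th coefficient is asymptotic to \<open>1 / \<rho> ^ (n + 1)\<close>
  (\<open>simple_pole_coefficient_asymptotics\<close>).\<close>

section \<open>The exponential formula\<close>

definition partition_sum :: "(nat \<Rightarrow> 'a) \<Rightarrow> (nat \<Rightarrow> 'a) \<Rightarrow> 'b set \<Rightarrow> 'a::field_char_0" where
  "partition_sum f a S = (\<Sum>\<pi> | partition_on S \<pi>. f (card \<pi>) * (\<Prod>B\<in>\<pi>. a (card B)))"

definition egf :: "(nat \<Rightarrow> 'a) \<Rightarrow> 'a::field_char_0 fps" where
  "egf a = Abs_fps (\<lambda>k. a k / fact k)"

lemma egf_nth [simp]: "fps_nth (egf a) k = a k / fact k"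
  by (simp add: egf_def)

lemma fps_deriv_egf: "fps_deriv (egf a) = egf (\<lambda>k. a (Suc k))"
  by (simp add: fps_eq_iff del: of_nat_Suc)

lemma partition_sum_cong:
  assumes "finite S" "\<And>k. 1 \<le> k \<Longrightarrow> k \<le> card S \<Longrightarrow> a k = b k"
  shows "partition_sum f a S = partition_sum f b S"
  unfolding partition_sum_def
proof (intro sum.cong refl arg_cong2[of _ _ _ _ "(*)"] prod.cong)
  fix \<pi> B assume *: "\<pi> \<in> {\<pi>. partition_on S \<pi>}" "B \<in> \<pi>"
  then have "B \<subseteq> S" "B \<noteq> {}"
    by (auto simp: partition_on_def)
  then show "a (card B) = b (card B)"
    using assms by (metis One_nat_def Suc_leI card_gt_0_iff card_mono finite_subset)
qed

text \<open>Sort the partitions of \<open>insert x S\<close> by the block \<open>insert x T\<close> that contains \<open>x\<close>.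
  Removing it leaves an arbitrary partition of \<open>S - T\<close> with one block fewer, hence the shifted
  weights \<open>\<lambda>k. f (Suc k)\<close>.\<close>
lemma partition_sum_insert:
  assumes "finite S" "x \<notin> S"
  shows "partition_sum f a (insert x S) =
    (\<Sum>T\<in>Pow S. a (Suc (card T)) * partition_sum (\<lambda>k. f (Suc k)) a (S - T))"
proof -
  let ?D = "SIGMA T:Pow S. {\<sigma>. partition_on (S - T) \<sigma>}"
  let ?h = "\<lambda>(T, \<sigma>). insert (insert x T) \<sigma>"
  let ?blk = "\<lambda>\<pi>. \<Union>{B\<in>\<pi>. x \<in> B}"
  let ?g = "\<lambda>\<pi>. (?blk \<pi> - {x}, \<pi> - {?blk \<pi>})"
  have blk: "?blk \<pi> = B" if "partition_on (insert x S) \<pi>" "B \<in> \<pi>" "x \<in> B" for \<pi> B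
  proof -
    have "{B\<in>\<pi>. x \<in> B} = {B}"
      using that by (auto simp: partition_on_def pairwise_def disjnt_iff)
    then show ?thesis by simp
  qed
  have notin: "insert x T \<notin> \<sigma>" "x \<notin> \<Union>\<sigma>" if "partition_on (S - T) \<sigma>" for T \<sigma>
    using that assms by (auto simp: partition_on_def)
  have part: "partition_on (insert x S) (insert (insert x T) \<sigma>)"
    if "T \<subseteq> S" "partition_on (S - T) \<sigma>" for T \<sigma>
  proof -
    have "disjnt (insert x T) (\<Union>\<sigma>)"
      using that assms by (auto simp: disjnt_iff partition_on_def)
    moreover have "insert x S - insert x T = S - T"
      using assms by auto
    ultimately show ?thesis
      using that by (subst partition_on_insert) auto
  qed
  \<comment> \<open>\<open>?h\<close> adds the block of \<open>x\<close> and \<open>?g\<close> splits it off again.\<close>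
  have "bij_betw ?h ?D {\<pi>. partition_on (insert x S) \<pi>}"
  proof (rule bij_betw_byWitness[where f' = ?g])
    show "\<forall>p\<in>?D. ?g (?h p) = p"
    proof
      fix p assume "p \<in> ?D"
      then obtain T \<sigma> where p: "p = (T, \<sigma>)" and *: "T \<subseteq> S" "partition_on (S - T) \<sigma>"
        by auto
      have "?blk (insert (insert x T) \<sigma>) = insert x T"
        by (rule blk[OF part[OF *]]) auto
      then show "?g (?h p) = p"
        unfolding p using * notin[OF *(2)] assms by auto
    qed
    have inv: "?g \<pi> \<in> ?D \<and> ?h (?g \<pi>) = \<pi>" if \<pi>: "partition_on (insert x S) \<pi>" for \<pi>
    proof -
      obtain B where B: "B \<in> \<pi>" "x \<in> B"
        using \<pi> by (auto simp: partition_on_def)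
      have b: "?blk \<pi> = B" by (rule blk[OF \<pi> B])
      have "disjnt B (\<Union>(\<pi> - {B}))"
        using \<pi> B by (auto simp: partition_on_def pairwise_def disjnt_iff)
      from partition_on_insert[OF this, of "insert x S"] have "partition_on (insert x S - B) (\<pi> - {B})" "B \<subseteq> insert x S"
        using \<pi> B by (auto simp: insert_absorb)
      moreover have "insert x S - B = S - (B - {x})" using B assms by auto
      ultimately show ?thesis
        using B unfolding b by (auto simp: insert_absorb)
    qed
    show "\<forall>\<pi>\<in>{\<pi>. partition_on (insert x S) \<pi>}. ?h (?g \<pi>) = \<pi>"
      using inv by blast
    show "?h ` ?D \<subseteq> {\<pi>. partition_on (insert x S) \<pi>}"
      using part by auto
    show "?g ` {\<pi>. partition_on (insert x S) \<pi>} \<subseteq> ?D"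
      using inv by blast
  qed
  then have "partition_sum f a (insert x S) = (\<Sum>(T,\<sigma>)\<in>?D. f (card (insert (insert x T) \<sigma>)) * (\<Prod>B\<in>insert (insert x T) \<sigma>. a (card B)))"
    unfolding partition_sum_def
    by (subst sum.reindex_bij_betw[symmetric, of ?h]) (auto simp: case_prod_unfold)
  also have "\<dots> = (\<Sum>(T,\<sigma>)\<in>?D. a (Suc (card T)) * (f (Suc (card \<sigma>)) * (\<Prod>B\<in>\<sigma>. a (card B))))"
  proof (intro sum.cong refl, clarify)
    fix T \<sigma> assume *: "T \<subseteq> S" "partition_on (S - T) \<sigma>"
    have "finite \<sigma>" "finite T" "x \<notin> T"
      using * assms finite_subset finite_elements[OF _ *(2)] by auto
    then show "f (card (insert (insert x T) \<sigma>)) * (\<Prod>B\<in>insert (insert x T) \<sigma>. a (card B))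
        = a (Suc (card T)) * (f (Suc (card \<sigma>)) * (\<Prod>B\<in>\<sigma>. a (card B)))"
      using notin[OF *(2)] by simp
  qed
  also have "\<dots> = (\<Sum>T\<in>Pow S. \<Sum>\<sigma> | partition_on (S - T) \<sigma>. a (Suc (card T)) * (f (Suc (card \<sigma>)) * (\<Prod>B\<in>\<sigma>. a (card B))))"
    using assms by (subst sum.Sigma) (auto intro: finitely_many_partition_on)
  finally show ?thesis
    by (simp add: partition_sum_def sum_distrib_left)
qed

lemma sum_Pow_card:
  fixes h :: "nat \<Rightarrow> 'a::comm_semiring_1"
  assumes "finite S"
  shows "(\<Sum>T\<in>Pow S. h (card T)) = (\<Sum>j\<le>card S. of_nat (card S choose j) * h j)"
proof -
  have "(\<Sum>T\<in>Pow S. h (card T)) = (\<Sum>j\<le>card S. \<Sum>T\<in>{T\<in>Pow S. card T = j}. h (card T))"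
    using assms by (intro sum.group[symmetric]) (auto intro: card_mono)
  also have "\<dots> = (\<Sum>j\<le>card S. of_nat (card S choose j) * h j)"
    using n_subsets[OF assms] by simp
  finally show ?thesis .
qed

text \<open>The exponential formula, also known as the formula of Faa di Bruno. Shifting the weights \<open>f\<close> is
  differentiation of \<open>egf f\<close>, so the recursion on the block of a distinguished element is, coefficient
  by coefficient, the chain rule for \<open>egf f oo egf a\<close>. Composition of power series
  requires \<open>a 0 = 0\<close>.\<close>
lemma partition_sum_eq_egf_compose:
  assumes "finite S" "a 0 = 0"
  shows "partition_sum f a S = fact (card S) * fps_nth (egf f oo egf a) (card S)"
  using assms(1)
proof (induction "card S" arbitrary: S f rule: less_induct)
  case less
  show ?case
  proof (cases "S = {}")
    case True
    then show ?thesis by (simp add: partition_sum_def partition_on_empty)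
  next
    case False
    then obtain x S' where S: "S = insert x S'" "x \<notin> S'" by (meson mk_disjoint_insert ex_in_conv)
    then have fin: "finite S'" and card: "card S = Suc (card S')" using less.prems by auto
    define n where "n = card S'"
    let ?f' = "\<lambda>k. f (Suc k)"
    let ?G = "egf ?f' oo egf a"
    have "partition_sum f a S = (\<Sum>T\<in>Pow S'. a (Suc (card T)) * partition_sum ?f' a (S' - T))"
      unfolding S(1) by (rule partition_sum_insert) (use S fin in auto)
    also have "\<dots> = (\<Sum>T\<in>Pow S'. a (Suc (card T)) * (fact (n - card T) * fps_nth ?G (n - card T)))"
    proof (intro sum.cong refl arg_cong2[of _ _ _ _ "(*)"])
      fix T assume T: "T \<in> Pow S'"
      then have "finite T" using fin finite_subset by blast
      then have c: "card (S' - T) = n - card T" using T by (simp add: card_Diff_subset n_def)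
      show "partition_sum ?f' a (S' - T) = fact (n - card T) * fps_nth ?G (n - card T)"
        using less.hyps[of "S' - T" ?f'] c card fin by (simp add: n_def)
    qed
    also have "\<dots> = (\<Sum>j\<le>n. of_nat (n choose j) * (a (Suc j) * (fact (n - j) * fps_nth ?G (n - j))))"
      using sum_Pow_card[OF fin, of "\<lambda>j. a (Suc j) * (fact (n - j) * fps_nth ?G (n - j))"] by (simp add: n_def)
    also have "\<dots> = (\<Sum>j\<le>n. fact n * (fps_nth (fps_deriv (egf a)) j * fps_nth ?G (n - j)))"
      by (intro sum.cong refl) (simp add: binomial_fact fps_deriv_egf del: fps_deriv_nth)
    also have "\<dots> = fact n * fps_nth (fps_deriv (egf a) * ?G) n"
      by (simp add: fps_mult_nth sum_distrib_left atLeast0AtMost)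
    also have "fps_deriv (egf a) * ?G = fps_deriv (egf f oo egf a)"
      using assms(2) by (simp add: fps_compose_deriv fps_deriv_egf[of f])
    also have "fact n * fps_nth (fps_deriv (egf f oo egf a)) n = fact (card S) * fps_nth (egf f oo egf a) (card S)"
      by (simp add: card n_def)
    finally show ?thesis .
  qed
qed

lemma egf_geometric: "egf (\<lambda>k. c ^ k * fact k) = inverse (1 - fps_const c * fps_X)"
  for c :: "'a::field_char_0"
proof -
  let ?E = "egf (\<lambda>k. c ^ k * fact k)"
  have "?E = 1 + fps_const c * (fps_X * ?E)"
    by (rule fps_ext, case_tac n) (simp_all del: of_nat_Suc)
  then have "?E * (1 - fps_const c * fps_X) = 1"
    by (simp add: algebra_simps)
  then show ?thesis by (metis fps_inverse_unique mult.commute)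
qed

text \<open>For \<open>c \<noteq> 0\<close> and up to an additive constant, \<open>egf f\<close> is \<open>- ln (1 - c x) / c\<close>. Differentiating the composition
  turns the logarithm into a rational expression in \<open>egf a\<close> and its derivative, and this is what makes
  both applications tractable: \<open>c = -1\<close> gives cumulants, \<open>c = 1\<close> gives \<open>C_cen\<close>.\<close>
lemma partition_sum_log_weights:
  fixes a :: "nat \<Rightarrow> 'a::field_char_0"
  assumes "finite S" "card S = Suc n" "a 0 = 0" "\<And>k. f (Suc k) = c ^ k * fact k"
  shows "partition_sum f a S = fact n * fps_nth (fps_deriv (egf a) / (1 - fps_const c * egf a)) n"
proof -
  have "fps_deriv (egf f oo egf a) = (inverse (1 - fps_const c * fps_X) oo egf a) * fps_deriv (egf a)"
    using assms by (simp add: fps_compose_deriv fps_deriv_egf[of f] egf_geometric)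
  also have "inverse (1 - fps_const c * fps_X) oo egf a = inverse (1 - fps_const c * egf a)"
    using assms(3) by (simp add: fps_inverse_compose fps_compose_sub_distrib fps_compose_mult_distrib)
  finally have "fps_deriv (egf f oo egf a) = fps_deriv (egf a) / (1 - fps_const c * egf a)"
    using assms(3) by (simp add: fps_divide_unit)
  from arg_cong[OF this, of "\<lambda>F. fact n * fps_nth F n"] show ?thesis
    using partition_sum_eq_egf_compose[of S a f] assms by (simp add: algebra_simps)
qed

section \<open>Translation invariance of cumulants\<close>

text \<open>With these weights \<open>partition_sum f u S\<close> is a coefficient of \<open>ln (egf u)\<close>. The binomial transform
  \<open>v\<close> satisfies \<open>egf v = exp (\<mu> x) * egf u\<close>, so its logarithm differs from that of \<open>egf u\<close> by \<open>\<mu> x\<close> only,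
  which is invisible in degree at least 2. The argument is carried out on logarithmic derivatives.\<close>
lemma partition_sum_log_translate:
  fixes u v :: "nat \<Rightarrow> 'a::field_char_0"
  assumes S: "finite S" "2 \<le> card S"
    and u0: "u 0 = 1"
    and v: "\<And>k. v k = (\<Sum>j\<le>k. of_nat (k choose j) * \<mu> ^ (k - j) * u j)"
    and f: "\<And>k. f (Suc k) = (- 1) ^ k * fact k"
  shows "partition_sum f v S = partition_sum f u S"
proof -
  obtain n where n: "card S = Suc n" "n \<ge> 1"
    using S(2) by (cases "card S") auto
  have log: "partition_sum f w S = fact n * fps_nth (fps_deriv (egf w) / egf w) n"
    if w0: "w 0 = 1" for w
  proof -
    \<comment> \<open>Moving the constant term 1 of \<open>egf w\<close> out of the sequence makes \<open>egf ?w\<close> composable.\<close>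
    let ?w = "w(0 := 0)"
    have w: "egf w = 1 + egf ?w"
      by (simp add: fps_eq_iff w0)
    have "partition_sum f w S = partition_sum f ?w S"
      using S by (intro partition_sum_cong) auto
    also have "\<dots> = fact n * fps_nth (fps_deriv (egf ?w) / (1 - fps_const (-1) * egf ?w)) n"
      using S(1) n(1) f by (intro partition_sum_log_weights) auto
    also have "1 - fps_const (-1) * egf ?w = egf w"
      by (simp add: w flip: fps_const_neg)
    also have "fps_deriv (egf ?w) = fps_deriv (egf w)"
      by (simp add: w)
    finally show ?thesis .
  qed
  have v0: "v 0 = 1"
    using u0 by (simp add: v)
  have "egf v = fps_exp \<mu> * egf u"
  proof (rule fps_ext)
    fix k
    have "fps_nth (fps_exp \<mu> * egf u) k = fps_nth (egf u * fps_exp \<mu>) k"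
      by (simp add: mult.commute)
    also have "\<dots> = fps_nth (egf v) k"
      by (simp add: fps_mult_nth v sum_divide_distrib atLeast0AtMost)
         (intro sum.cong refl, simp add: binomial_fact field_simps)
    finally show "fps_nth (egf v) k = fps_nth (fps_exp \<mu> * egf u) k" ..
  qed
  then have "fps_deriv (egf v) = fps_const \<mu> * egf v + fps_exp \<mu> * fps_deriv (egf u)"
    by (simp add: algebra_simps)
  moreover have "fps_exp \<mu> * fps_deriv (egf u) = (fps_deriv (egf u) / egf u) * egf v"
  proof -
    have "inverse (egf u) * egf u = 1"
      using u0 by (intro inverse_mult_eq_1) auto
    with \<open>egf v = fps_exp \<mu> * egf u\<close> show ?thesis
      using u0 by (simp add: fps_divide_unit mult.assoc mult.left_commute)
  qed
  ultimately have "fps_deriv (egf v) = (fps_const \<mu> + fps_deriv (egf u) / egf u) * egf v"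
    by (simp add: algebra_simps)
  moreover have "egf v \<noteq> 0"
    using v0 by (metis div_by_1 egf_nth fact_0 fps_zero_nth zero_neq_one)
  ultimately have "fps_deriv (egf v) / egf v = fps_const \<mu> + fps_deriv (egf u) / egf u"
    by simp
  with n show ?thesis
    using log[of u] log[of v] u0 v0 by simp
qed

lemma (in prob_space) moment_add_const:
  fixes Y :: "'a \<Rightarrow> real"
  assumes "\<And>j. j \<le> k \<Longrightarrow> integrable M (\<lambda>\<omega>. Y \<omega> ^ j)"
  shows "moment M (\<lambda>\<omega>. Y \<omega> + \<mu>) k = (\<Sum>j\<le>k. of_nat (k choose j) * \<mu> ^ (k - j) * moment M Y j)"
proof -
  have "moment M (\<lambda>\<omega>. Y \<omega> + \<mu>) k = (\<integral>\<omega>. (\<Sum>j\<le>k. (of_nat (k choose j) * \<mu> ^ (k - j)) * Y \<omega> ^ j) \<partial>M)"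
    unfolding moment_def by (simp add: binomial_ring mult_ac)
  also have "\<dots> = (\<Sum>j\<le>k. of_nat (k choose j) * \<mu> ^ (k - j) * moment M Y j)"
    unfolding moment_def using assms by (subst Bochner_Integration.integral_sum) auto
  finally show ?thesis .
qed

lemma (in prob_space) cumulant_add_const:
  fixes Y :: "'a \<Rightarrow> real"
  assumes "\<And>j. j \<le> n \<Longrightarrow> integrable M (\<lambda>\<omega>. Y \<omega> ^ j)" "2 \<le> n"
  shows "cumulant M (\<lambda>\<omega>. Y \<omega> + \<mu>) n = cumulant M Y n"
proof -
  define f :: "nat \<Rightarrow> real" where "f = (\<lambda>k. (- 1) ^ (k - 1) * fact (k - 1))"
  \<comment> \<open>Moments of order above \<open>n\<close> need not exist, so \<open>v\<close> is defined by the binomial formula in all orders;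
      it agrees with the moments of the translate in the orders that matter.\<close>
  define v where "v = (\<lambda>k. \<Sum>j\<le>k. of_nat (k choose j) * \<mu> ^ (k - j) * moment M Y j)"
  have cum: "cumulant M Z n = partition_sum f (moment M Z) {1..n}" for Z
    by (simp add: cumulant_def set_partitions_def partition_sum_def f_def)
  have "cumulant M (\<lambda>\<omega>. Y \<omega> + \<mu>) n = partition_sum f v {1..n}"
    unfolding cum v_def using assms by (intro partition_sum_cong) (auto intro!: moment_add_const)
  also have "\<dots> = partition_sum f (moment M Y) {1..n}"
    using assms by (intro partition_sum_log_translate) (auto simp: v_def f_def moment_def prob_space)
  finally show ?thesis by (simp only: cum)
qed

section \<open>The bound by the central moment\<close>

text \<open>Weighted arithmetic-geometric mean inequality for \<open>t ^ n\<close> and \<open>1\<close> with weights \<open>k / n\<close> and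
  \<open>1 - k / n\<close>.\<close>
lemma power_le_weighted_mean:
  fixes t :: real
  assumes "0 \<le> t" "k \<le> n" "0 < n"
  shows "t ^ k \<le> k / n * t ^ n + (1 - k / n)"
proof (cases "t = 0")
  case True
  then show ?thesis using assms by (cases k) auto
next
  case False
  then have t: "t > 0" using assms by simp
  have "(t ^ n) powr (k / n) * 1 powr (1 - k / n) \<le> k / n * t ^ n + (1 - k / n) * 1"
    using assms t by (intro Youngs_inequality_0) auto
  moreover have "(t ^ n) powr (k / n) = t ^ k"
    using assms t by (simp add: powr_powr flip: powr_realpow)
  ultimately show ?thesis by simp
qed

text \<open>Lyapunov's inequality \<open>E|Y|^k \<le> (E|Y|^n)^(k/n)\<close>, obtained by integrating the preceding inequality
  at \<open>t = |Y| / c\<close>. Stating it for every positive upper bound \<open>c\<close> of the \<open>n\<close>-th root, and not for the root itself, avoids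
  dividing by zero when \<open>Y\<close> vanishes almost surely.\<close>
lemma (in prob_space) abs_moment_le_power:
  fixes Y :: "'a \<Rightarrow> real"
  assumes [measurable]: "Y \<in> borel_measurable M"
    and int: "integrable M (\<lambda>\<omega>. \<bar>Y \<omega>\<bar> ^ n)" and "k \<le> n" "0 < n"
  shows "integrable M (\<lambda>\<omega>. Y \<omega> ^ k)"
    and "0 < c \<Longrightarrow> (\<integral>\<omega>. \<bar>Y \<omega>\<bar> ^ n \<partial>M) \<le> c ^ n \<Longrightarrow> \<bar>moment M Y k\<bar> \<le> c ^ k"
proof -
  have bound: "\<bar>Y \<omega>\<bar> ^ k \<le> c ^ k * (k / n * (\<bar>Y \<omega>\<bar> ^ n / c ^ n) + (1 - k / n))" if "0 < c" for c \<omega>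
    using power_le_weighted_mean[of "\<bar>Y \<omega>\<bar> / c" k n] assms that
    by (simp add: power_divide field_simps)
  show integrable: "integrable M (\<lambda>\<omega>. Y \<omega> ^ k)"
  proof (rule Bochner_Integration.integrable_bound)
    show "integrable M (\<lambda>\<omega>. k / n * \<bar>Y \<omega>\<bar> ^ n + (1 - k / n))"
      using int by simp
    show "AE \<omega> in M. norm (Y \<omega> ^ k) \<le> norm (k / n * \<bar>Y \<omega>\<bar> ^ n + (1 - k / n))"
      using order_trans[OF bound[of 1] abs_ge_self] by (intro AE_I2) (simp add: power_abs)
  qed simp
  assume c: "0 < c" "(\<integral>\<omega>. \<bar>Y \<omega>\<bar> ^ n \<partial>M) \<le> c ^ n"
  have "\<bar>moment M Y k\<bar> \<le> (\<integral>\<omega>. \<bar>Y \<omega>\<bar> ^ k \<partial>M)"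
    unfolding moment_def using integral_abs_bound[of M "\<lambda>\<omega>. Y \<omega> ^ k"] by (simp add: power_abs)
  also have "\<dots> \<le> (\<integral>\<omega>. c ^ k * (k / n * (\<bar>Y \<omega>\<bar> ^ n / c ^ n) + (1 - k / n)) \<partial>M)"
    using integrable_abs[OF integrable] int bound[OF c(1)]
    by (intro integral_mono) (auto simp: power_abs)
  also have "\<dots> = c ^ k * (k / n * ((\<integral>\<omega>. \<bar>Y \<omega>\<bar> ^ n \<partial>M) / c ^ n) + (1 - k / n))"
    using int by (simp add: prob_space)
  also have "\<dots> \<le> c ^ k * (k / n * 1 + (1 - k / n))"
    using c by (intro mult_left_mono add_right_mono) auto
  finally show "\<bar>moment M Y k\<bar> \<le> c ^ k" by simp
qed

lemma finite_set_partitions: "finite (set_partitions n)"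
  unfolding set_partitions_def by (intro finitely_many_partition_on) simp

text \<open>For a centred variable a partition with a singleton block contributes nothing, because the first
  moment is a factor of its term. For every other partition the block sizes add up to \<open>n\<close>, so the
  Lyapunov bounds of its factors multiply to \<open>E|Y|^n\<close>.\<close>
lemma (in prob_space) abs_cumulant_le:
  fixes Y :: "'a \<Rightarrow> real"
  assumes meas: "Y \<in> borel_measurable M" and int: "integrable M (\<lambda>\<omega>. \<bar>Y \<omega>\<bar> ^ n)"
    and mean: "(\<integral>\<omega>. Y \<omega> \<partial>M) = 0" and n: "0 < n"
  shows "\<bar>cumulant M Y n\<bar> \<le> C_cen n * (\<integral>\<omega>. \<bar>Y \<omega>\<bar> ^ n \<partial>M)"
proof -
  define N where "N = (\<integral>\<omega>. \<bar>Y \<omega>\<bar> ^ n \<partial>M)"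
  have block: "finite B" "B \<noteq> {}" "B \<subseteq> {1..n}" if "\<pi> \<in> set_partitions n" "B \<in> \<pi>" for \<pi> B
    using that finite_subset[of B "{1..n}"] by (auto simp: set_partitions_def partition_on_def)
  have fin: "finite \<pi>" if "\<pi> \<in> set_partitions n" for \<pi>
    using that finite_elements[of "{1..n}"] by (auto simp: set_partitions_def)
  have "N \<ge> 0" unfolding N_def by simp
  have prod: "\<bar>\<Prod>B\<in>\<pi>. moment M Y (card B)\<bar> \<le> N" if \<pi>: "\<pi> \<in> set_partitions n" for \<pi>
  proof (rule field_le_epsilon)
    fix e :: real assume "e > 0"
    define c where "c = root n (N + e)"
    have c: "c > 0" "c ^ n = N + e"
      using \<open>N \<ge> 0\<close> \<open>e > 0\<close> n by (auto simp: c_def)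
    have "\<bar>\<Prod>B\<in>\<pi>. moment M Y (card B)\<bar> = (\<Prod>B\<in>\<pi>. \<bar>moment M Y (card B)\<bar>)"
      by (rule abs_prod)
    also have "\<dots> \<le> (\<Prod>B\<in>\<pi>. c ^ card B)"
    proof (intro prod_mono conjI)
      fix B assume "B \<in> \<pi>"
      then have "card B \<le> n"
        using card_mono[OF _ block(3)[OF \<pi>]] by fastforce
      then show "\<bar>moment M Y (card B)\<bar> \<le> c ^ card B"
        using c \<open>e > 0\<close> by (intro abs_moment_le_power(2)[OF meas int _ n]) (auto simp flip: N_def)
    qed simp
    also have "\<dots> = c ^ (\<Sum>B\<in>\<pi>. card B)"
      by (rule power_sum[symmetric])
    also have "(\<Sum>B\<in>\<pi>. card B) = card (\<Union>\<pi>)"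
      using \<pi> block by (subst card_Union_disjoint) (auto simp: set_partitions_def partition_on_def)
    also have "\<Union>\<pi> = {1..n}"
      using \<pi> by (auto simp: set_partitions_def partition_on_def)
    finally show "\<bar>\<Prod>B\<in>\<pi>. moment M Y (card B)\<bar> \<le> N + e"
      using c by simp
  qed
  have zero: "(\<Prod>B\<in>\<pi>. moment M Y (card B)) = 0" if \<pi>: "\<pi> \<in> set_partitions n - set_partitions_ge2 n" for \<pi>
  proof -
    obtain B where B: "B \<in> \<pi>" "\<not> 2 \<le> card B"
      using \<pi> by (auto simp: set_partitions_ge2_def)
    moreover have "card B \<noteq> 0"
      using block[OF _ B(1)] \<pi> by simp
    ultimately have "card B = 1" by linarith
    then have "moment M Y (card B) = 0"
      using mean by (simp add: moment_def)
    then show ?thesis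
      using fin \<pi> B(1) by (intro prod_zero) auto
  qed
  have "cumulant M Y n = (\<Sum>\<pi>\<in>set_partitions_ge2 n. (- 1) ^ (card \<pi> - 1) * fact (card \<pi> - 1) * (\<Prod>B\<in>\<pi>. moment M Y (card B)))"
    unfolding cumulant_def
    by (rule sum.mono_neutral_right) (use zero finite_set_partitions in \<open>auto simp: set_partitions_ge2_def\<close>)
  also have "\<bar>\<dots>\<bar> \<le> (\<Sum>\<pi>\<in>set_partitions_ge2 n. fact (card \<pi> - 1) * N)"
  proof (rule order_trans[OF sum_abs], rule sum_mono)
    fix \<pi> assume "\<pi> \<in> set_partitions_ge2 n"
    then show "\<bar>(- 1) ^ (card \<pi> - 1) * fact (card \<pi> - 1) * (\<Prod>B\<in>\<pi>. moment M Y (card B))\<bar> \<le> fact (card \<pi> - 1) * N"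
      using prod[of \<pi>] by (auto simp: abs_mult power_abs set_partitions_ge2_def intro!: mult_left_mono)
  qed
  finally show ?thesis
    by (simp add: C_cen_def sum_distrib_right N_def)
qed

lemma (in prob_space) abs_cumulant_le_central_moment:
  fixes X :: "'a \<Rightarrow> real"
  assumes X: "integrable M X" and n: "2 \<le> n"
    and int: "integrable M (\<lambda>\<omega>. \<bar>X \<omega> - (\<integral>\<omega>'. X \<omega>' \<partial>M)\<bar> ^ n)"
  shows "\<bar>cumulant M X n\<bar> \<le> C_cen n * (\<integral>\<omega>. \<bar>X \<omega> - (\<integral>\<omega>'. X \<omega>' \<partial>M)\<bar> ^ n \<partial>M)"
proof -
  define \<mu> where "\<mu> = (\<integral>\<omega>. X \<omega> \<partial>M)"
  define Y where "Y = (\<lambda>\<omega>. X \<omega> - \<mu>)"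
  have Y: "Y \<in> borel_measurable M" "integrable M (\<lambda>\<omega>. \<bar>Y \<omega>\<bar> ^ n)" "(\<integral>\<omega>. Y \<omega> \<partial>M) = 0"
    using X int by (auto simp: Y_def \<mu>_def prob_space)
  have "cumulant M X n = cumulant M (\<lambda>\<omega>. Y \<omega> + \<mu>) n"
    by (simp add: Y_def)
  also have "\<dots> = cumulant M Y n"
    using n abs_moment_le_power(1)[OF Y(1,2)] by (intro cumulant_add_const) auto
  finally show ?thesis
    using abs_cumulant_le[OF Y] n by (simp add: Y_def \<mu>_def)
qed

section \<open>Coefficients at a dominant simple pole\<close>

lemma coeff_times_power_tendsto_0:
  assumes "h holomorphic_on ball 0 r" "h has_fps_expansion F" "norm z < r"
  shows "(\<lambda>n. fps_nth F n * z ^ n) \<longlonglongrightarrow> 0"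
proof -
  have "h holomorphic_on eball 0 (ereal r)" using assms(1) by simp
  from conv_radius_fps_expansion[OF this] have "ereal (norm z) < fps_conv_radius (fps_expansion h 0)"
    using assms(3) by (meson ereal_less_eq(3) less_ereal.simps(1) less_le_trans)
  also have "fps_expansion h 0 = F"
    using assms(2) by (intro fps_expansion_eqI)
  finally show ?thesis
    by (intro summable_LIMSEQ_zero summable_fps) auto
qed

text \<open>The zeros of modulus at most \<open>\<rho> + 1\<close> form a compact set, so one of them, if there is any, has least
  modulus.\<close>
lemma nonzero_cball_imp_nonzero_larger_ball:
  fixes H :: "complex \<Rightarrow> complex"
  assumes cont: "continuous_on UNIV H" and nz: "\<And>z. norm z \<le> \<rho> \<Longrightarrow> H z \<noteq> 0"
  obtains r where "\<rho> < r" "\<And>z. norm z < r \<Longrightarrow> H z \<noteq> 0"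
proof -
  let ?K = "{z. H z = 0} \<inter> cball 0 (\<rho> + 1)"
  have "closed {z. H z = 0}"
    using continuous_closed_vimage[of "{0}" H] cont
    by (simp add: vimage_def continuous_on_eq_continuous_at)
  then have K: "compact ?K" by (intro closed_Int_compact) auto
  show thesis
  proof (cases "?K = {}")
    case True
    then show ?thesis using that[of "\<rho> + 1"] by fastforce
  next
    case False
    then obtain w where w: "w \<in> ?K" "\<forall>z\<in>?K. norm w \<le> norm z"
      using continuous_attains_inf[OF K False continuous_on_norm_id] by blast
    show ?thesis
    proof (rule that[of "norm w"])
      show "\<rho> < norm w" using w(1) nz[of w] by force
      show "H z \<noteq> 0" if "norm z < norm w" for z
        using w that by force
    qed
  qed
qed

text \<open>The function \<open>- D' / D\<close> has residue -1 at the simple zero \<open>\<rho>\<close> of \<open>D\<close>. Its polar part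
  \<open>1 / (\<rho> - z)\<close> has coefficients \<open>1 / \<rho> ^ (n + 1)\<close>. Writing \<open>D z = (z - \<rho>) * H z\<close>, the remainder
  is \<open>- H' / H\<close>, which is holomorphic on a disc of radius larger than \<open>\<rho>\<close> because \<open>H\<close> does not vanish
  on the closed disc of radius \<open>\<rho>\<close>; so the coefficients of the remainder are \<open>o(1 / \<rho> ^ n)\<close>.\<close>
lemma simple_pole_coefficient_asymptotics:
  fixes \<rho> :: real and D D' :: "complex \<Rightarrow> complex"
  assumes \<rho>: "0 < \<rho>"
    and D: "\<And>z. (D has_field_derivative D' z) (at z)"
    and zero: "D (of_real \<rho>) = 0" and simple: "D' (of_real \<rho>) \<noteq> 0"
    and only: "\<And>z. norm z \<le> \<rho> \<Longrightarrow> D z = 0 \<Longrightarrow> z = of_real \<rho>"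
    and F: "(\<lambda>z. - D' z / D z) has_fps_expansion F"
  shows "(\<lambda>n. fps_nth F n * of_real \<rho> ^ Suc n) \<longlonglongrightarrow> 1"
proof -
  let ?\<rho> = "complex_of_real \<rho>"
  define H where "H = (\<lambda>z. if z = ?\<rho> then D' ?\<rho> else D z / (z - ?\<rho>))"
  have "D holomorphic_on UNIV"
    using D by (meson field_differentiable_at_within field_differentiable_def holomorphic_on_def)
  from pole_lemma_open[OF this open_UNIV, of ?\<rho>] have holH: "H holomorphic_on UNIV"
    unfolding H_def DERIV_imp_deriv[OF D] zero by (simp cong: if_cong)
  have "H z \<noteq> 0" if "norm z \<le> \<rho>" for z
    using only[OF that] simple by (auto simp: H_def)
  then obtain r where r: "\<rho> < r" "\<And>z. norm z < r \<Longrightarrow> H z \<noteq> 0"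
    using nonzero_cball_imp_nonzero_larger_ball holomorphic_on_imp_continuous_on[OF holH] by metis
  define h where "h = (\<lambda>z. - deriv H z / H z)"
  have holh: "h holomorphic_on ball 0 r"
    unfolding h_def using r(2) holH
    by (intro holomorphic_intros holomorphic_deriv[of H UNIV, THEN holomorphic_on_subset])
       (auto intro: holomorphic_on_subset)
  \<comment> \<open>The polar part is written as the geometric series \<open>c / (1 - c z)\<close> with ratio \<open>c\<close>.\<close>
  define c where "c = 1 / ?\<rho>"
  have h_eq: "h z = - D' z / D z - c * inverse (1 - c * z)" if "norm z < \<rho>" for z
  proof -
    have z: "z \<noteq> ?\<rho>" "z - ?\<rho> \<noteq> 0" using that by auto
    have Dz: "D z \<noteq> 0" using only[of z] that z by auto
    have "((\<lambda>w. D w / (w - ?\<rho>)) has_field_derivative (D' z * (z - ?\<rho>) - D z) / (z - ?\<rho>)\<^sup>2) (at z)"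
      using z by (auto intro!: derivative_eq_intros D simp: power2_eq_square)
    moreover have "eventually (\<lambda>w. H w = D w / (w - ?\<rho>)) (nhds z)"
      using t1_space_nhds[OF z(1)] by eventually_elim (simp add: H_def)
    ultimately have "(H has_field_derivative (D' z * (z - ?\<rho>) - D z) / (z - ?\<rho>)\<^sup>2) (at z)"
      by (subst DERIV_cong_ev[OF refl _ refl])
    then have "deriv H z = (D' z * (z - ?\<rho>) - D z) / (z - ?\<rho>)\<^sup>2"
      by (rule DERIV_imp_deriv)
    then have "h z = - ((D' z * (z - ?\<rho>) - D z) / (z - ?\<rho>)\<^sup>2) / (D z / (z - ?\<rho>))"
      using z(1) by (simp add: h_def H_def)
    also have "\<dots> = - D' z / D z + 1 / (z - ?\<rho>)"
    proof -
      have "- ((a * e - d) / e\<^sup>2) / (d / e) = - a / d + 1 / e" if "e \<noteq> 0" "d \<noteq> 0" for a d e :: complex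
        using that by (simp add: power2_eq_square divide_simps)
      from this[OF z(2) Dz] show ?thesis .
    qed
    also have "1 / (z - ?\<rho>) = - c * inverse (1 - c * z)"
      using z \<rho> by (simp add: c_def field_simps)
    finally show ?thesis by simp
  qed
  have "(\<lambda>z. - D' z / D z - c * inverse (1 - c * z)) has_fps_expansion
          F - fps_const c * inverse (1 - fps_const c * fps_X)"
    by (intro fps_expansion_intros F) simp
  moreover have "eventually (\<lambda>z. - D' z / D z - c * inverse (1 - c * z) = h z) (nhds 0)"
    using eventually_nhds_in_open[of "ball 0 \<rho>" "0::complex"] \<rho>
    by (auto elim!: eventually_mono simp: h_eq)
  ultimately have "h has_fps_expansion F - fps_const c * inverse (1 - fps_const c * fps_X)"
    by (simp add: has_fps_expansion_cong)
  from coeff_times_power_tendsto_0[OF holh this, of ?\<rho>]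
  have "(\<lambda>n. (fps_nth F n - c * c ^ n) * ?\<rho> ^ n) \<longlonglongrightarrow> 0"
    using r \<rho> by (simp flip: egf_geometric)
  from tendsto_add[OF tendsto_mult[OF tendsto_const[of ?\<rho>] this] tendsto_const[of 1]]
  show ?thesis
    using \<rho> by (simp add: c_def algebra_simps power_divide)
qed

section \<open>Asymptotics of the constant\<close>

lemma exp_eq_2_plus_unique: "\<exists>!\<rho>::real. 0 < \<rho> \<and> exp \<rho> = 2 + \<rho>"
proof (rule ex_ex1I)
  let ?\<phi> = "\<lambda>x::real. exp x - 2 - x"
  have "\<exists>x\<ge>0. x \<le> 2 \<and> ?\<phi> x = 0"
  proof (rule IVT')
    have "5 \<le> exp (2::real)"
      using exp_lower_Taylor_quadratic[of "2::real"] by simp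
    then show "0 \<le> ?\<phi> 2" by simp
  qed (auto intro!: continuous_intros)
  then obtain x where "0 \<le> x" "?\<phi> x = 0" by auto
  moreover from this have "x \<noteq> 0" by auto
  ultimately show "\<exists>\<rho>::real. 0 < \<rho> \<and> exp \<rho> = 2 + \<rho>"
    by (intro exI[of _ x]) auto
next
  \<comment> \<open>Beyond a positive solution \<open>x\<close>, the graph of \<open>exp\<close> stays above its tangent at \<open>x\<close>, of slope \<open>2 + x > 1\<close>.\<close>
  have False if "0 < x" "exp x = 2 + x" "exp y = 2 + y" "x < y" for x y :: real
  proof -
    have "exp y = exp x * exp (y - x)"
      by (simp flip: exp_add)
    also have "\<dots> \<ge> (2 + x) * (1 + (y - x))"
      using that by (intro mult_mono exp_ge_add_one_self) auto
    moreover have "(2 + x) * (1 + (y - x)) = 2 + y + (1 + x) * (y - x)"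
      by (simp add: algebra_simps)
    moreover have "(1 + x) * (y - x) > 0" using that by simp
    ultimately show False using that by simp
  qed
  then show "x = y" if "0 < x \<and> exp x = 2 + x" "0 < y \<and> exp y = 2 + y" for x y :: real
    using that by (meson linorder_neqE_linordered_idom)
qed

text \<open>The number 1 is the sum of \<open>\<rho> ^ k / k!\<close> over \<open>k \<ge> 2\<close> and also of \<open>z ^ k / k!\<close>. As \<open>|z| \<le> \<rho>\<close>, the real
  part of each term of the second series is at most the corresponding term of the first, so equality
  of the sums forces \<open>z ^ k = \<rho> ^ k\<close> for all \<open>k \<ge> 2\<close>. The exponents 2 and 3 are coprime and
  determine \<open>z\<close>.\<close>
lemma exp_eq_2_plus_in_disc:
  fixes z :: complex and \<rho> :: real
  assumes \<rho>: "0 < \<rho>" "exp \<rho> = 2 + \<rho>" and z: "norm z \<le> \<rho>" "exp z = 2 + z"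
  shows "z = of_real \<rho>"
proof -
  define d where "d = (\<lambda>k. \<rho> ^ (k + 2) / fact (k + 2) - Re (z ^ (k + 2)) / fact (k + 2))"
  have "(\<lambda>k. \<rho> ^ (k + 2) /\<^sub>R fact (k + 2)) sums (exp \<rho> - (\<Sum>k<2. \<rho> ^ k /\<^sub>R fact k))"
    by (rule sums_split_initial_segment[OF exp_converges])
  moreover have "(\<lambda>k. z ^ (k + 2) /\<^sub>R fact (k + 2)) sums (exp z - (\<Sum>k<2. z ^ k /\<^sub>R fact k))"
    by (rule sums_split_initial_segment[OF exp_converges])
  then have "(\<lambda>k. Re (z ^ (k + 2) /\<^sub>R fact (k + 2))) sums Re (exp z - (\<Sum>k<2. z ^ k /\<^sub>R fact k))"
    by (rule sums_Re)
  ultimately have "d sums ((exp \<rho> - (\<Sum>k<2. \<rho> ^ k /\<^sub>R fact k)) - Re (exp z - (\<Sum>k<2. z ^ k /\<^sub>R fact k)))"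
    using sums_diff by (fastforce simp: d_def divide_inverse mult.commute)
  moreover have "(exp \<rho> - (\<Sum>k<2. \<rho> ^ k /\<^sub>R fact k)) - Re (exp z - (\<Sum>k<2. z ^ k /\<^sub>R fact k)) = 0"
    by (simp add: \<rho> z(2) numeral_2_eq_2)
  ultimately have d: "d sums 0" by simp
  have le: "norm (z ^ k) \<le> \<rho> ^ k" for k
    using z(1) by (simp add: norm_power power_mono)
  have "d k \<ge> 0" for k
    using order_trans[OF complex_Re_le_cmod le[of "k + 2"]]
    by (simp add: d_def divide_right_mono del: power_Suc)
  then have d0: "d k = 0" for k
    using d suminf_eq_zero_iff[of d] by (auto simp: sums_iff)
  have eq: "z ^ (k + 2) = of_real (\<rho> ^ (k + 2))" for k
  proof -
    have re: "Re (z ^ (k + 2)) = \<rho> ^ (k + 2)"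
      using d0[of k] unfolding d_def by (simp del: power_Suc fact_Suc)
    moreover have "(Re (z ^ (k + 2)))\<^sup>2 + (Im (z ^ (k + 2)))\<^sup>2 \<le> (\<rho> ^ (k + 2))\<^sup>2"
      using power_mono[OF le[of "k + 2"], of 2] by (simp only: cmod_power2) simp
    ultimately have "Im (z ^ (k + 2)) = 0" by simp
    with re show ?thesis by (simp add: complex_eq_iff del: of_real_power)
  qed
  have "z ^ 2 * z = z ^ 2 * of_real \<rho>"
    using eq[of 0] eq[of 1] by (simp add: power2_eq_square power3_eq_cube numeral_3_eq_3)
  moreover have "z \<noteq> 0" using eq[of 0] \<rho> by auto
  ultimately show ?thesis by simp
qed

text \<open>Block weights 1 for sizes at least 2 and 0 otherwise have \<open>egf a = exp x - 1 - x\<close>; they select the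
  partitions without singletons. The series is complex in view of the analysis of its poles.\<close>
lemma C_cen_Suc_eq_coefficient:
  "complex_of_real (C_cen (Suc n)) = fact n * fps_nth ((fps_exp 1 - 1) / (2 + fps_X - fps_exp 1)) n"
proof -
  define a :: "nat \<Rightarrow> complex" where "a = (\<lambda>k. of_bool (2 \<le> k))"
  define f :: "nat \<Rightarrow> complex" where "f = (\<lambda>k. fact (k - 1))"
  let ?S = "{1..Suc n}"
  have prod_eq: "(\<Prod>B\<in>\<pi>. a (card B)) = of_bool (\<forall>B\<in>\<pi>. 2 \<le> card B)" if "partition_on ?S \<pi>" for \<pi>
    using finite_elements[OF _ that] by (auto simp: a_def)
  have "complex_of_real (C_cen (Suc n)) = (\<Sum>\<pi>\<in>set_partitions_ge2 (Suc n). f (card \<pi>))"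
    by (simp add: C_cen_def f_def)
  also have "\<dots> = (\<Sum>\<pi> | partition_on ?S \<pi>. f (card \<pi>) * of_bool (\<forall>B\<in>\<pi>. 2 \<le> card B))"
    by (rule sum.mono_neutral_cong_left)
       (auto simp: set_partitions_ge2_def set_partitions_def intro: finitely_many_partition_on)
  also have "\<dots> = partition_sum f a ?S"
    unfolding partition_sum_def by (intro sum.cong) (auto simp: prod_eq)
  also have "\<dots> = fact n * fps_nth (fps_deriv (egf a) / (1 - fps_const 1 * egf a)) n"
    by (intro partition_sum_log_weights) (auto simp: a_def f_def)
  also have "egf a = fps_exp 1 - 1 - fps_X"
    by (auto simp: fps_eq_iff a_def fps_X_def not_le numeral_2_eq_2 less_Suc_eq)
  also have "fps_deriv (fps_exp 1 - 1 - fps_X) = fps_exp 1 - (1 :: complex fps)"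
    by simp
  also have "1 - fps_const 1 * (fps_exp 1 - 1 - fps_X) = 2 + fps_X - (fps_exp 1 :: complex fps)"
    by simp
  finally show ?thesis .
qed

lemma C_cen_asymptotics:
  fixes \<rho> :: real
  assumes \<rho>: "0 < \<rho>" "exp \<rho> = 2 + \<rho>"
  shows "(\<lambda>n. C_cen n / (fact (n - 1) / \<rho> ^ n)) \<longlonglongrightarrow> 1"
proof (rule LIMSEQ_imp_Suc)
  let ?F = "(fps_exp 1 - 1) / (2 + fps_X - fps_exp 1) :: complex fps"
  let ?D = "\<lambda>z::complex. 2 + z - exp z" and ?D' = "\<lambda>z::complex. 1 - exp z"
  have exp_\<rho>: "exp (complex_of_real \<rho>) = 2 + of_real \<rho>"
    using \<rho>(2) by (metis exp_of_real of_real_add of_real_numeral)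
  have expansion: "(\<lambda>z. (exp z - 1) / ?D z) has_fps_expansion ?F"
    by (intro fps_expansion_intros) simp
  have "(\<lambda>n. fps_nth ?F n * of_real \<rho> ^ Suc n) \<longlonglongrightarrow> 1"
  proof (rule simple_pole_coefficient_asymptotics[OF \<rho>(1)])
    show "(\<lambda>z. - ?D' z / ?D z) has_fps_expansion ?F"
      using expansion by simp
    show "(?D has_field_derivative ?D' z) (at z)" for z
      by (auto intro!: derivative_eq_intros)
    show "?D (of_real \<rho>) = 0"
      by (simp add: exp_\<rho>)
    have "?D' (of_real \<rho>) = - of_real (1 + \<rho>)" by (simp add: exp_\<rho>)
    then show "?D' (of_real \<rho>) \<noteq> 0" using \<rho>(1) by (simp del: of_real_add)
    show "z = of_real \<rho>" if "norm z \<le> \<rho>" "?D z = 0" for z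
      using exp_eq_2_plus_in_disc[OF \<rho> that(1)] that(2) by simp
  qed
  moreover have "fps_nth ?F n * of_real \<rho> ^ Suc n = of_real (C_cen (Suc n) / (fact (Suc n - 1) / \<rho> ^ Suc n))" for n
    by (simp add: C_cen_Suc_eq_coefficient)
  ultimately have "(\<lambda>n. complex_of_real (C_cen (Suc n) / (fact (Suc n - 1) / \<rho> ^ Suc n))) \<longlonglongrightarrow> of_real 1"
    by simp
  then show "(\<lambda>n. C_cen (Suc n) / (fact (Suc n - 1) / \<rho> ^ Suc n)) \<longlonglongrightarrow> 1"
    by (subst (asm) tendsto_of_real_iff)
qed

theorem theorem3p6:
  shows "(\<forall>(M :: 'a measure) (X :: 'a \<Rightarrow> real) (n :: nat).
            prob_space M \<longrightarrow> integrable M X \<longrightarrow> 2 \<le> n \<longrightarrow>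
            integrable M (\<lambda>\<omega>. \<bar>X \<omega> - (\<integral>\<omega>'. X \<omega>' \<partial>M)\<bar> ^ n) \<longrightarrow>
            \<bar>cumulant M X n\<bar> \<le> C_cen n * (\<integral>\<omega>. \<bar>X \<omega> - (\<integral>\<omega>'. X \<omega>' \<partial>M)\<bar> ^ n \<partial>M)) \<and>
         (\<exists>!\<rho>::real. 0 < \<rho> \<and> exp \<rho> = 2 + \<rho>) \<and>
         (\<forall>\<rho>::real. 0 < \<rho> \<and> exp \<rho> = 2 + \<rho> \<longrightarrow>
            (\<lambda>n::nat. C_cen n / (fact (n - 1) / \<rho> ^ n)) \<longlonglongrightarrow> 1)"
  using prob_space.abs_cumulant_le_central_moment exp_eq_2_plus_unique C_cen_asymptotics
  by blast

end
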